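(* Let $u_\ell,v_\ell\in(0,\sigma)$, and let $w_r^1,w_r^2\geq 0$ with $w_r:=w_r^1+w_r^2\in(\sigma,\rho_{\max})$. Consider the merge scheme restricted to the two cells $J-1$ (one on each incoming road) and the cell $J$, i.e. for $n\ge0$ $$\mu_{J-1}^{n+1,p}=\mu_{J-1}^{n,p}-\frac{\Delta t}{\Delta x}\Big(G(\mu_{J-1}^{n,p},\omega_J^n)-G(\mu_{J-2}^{n,p},\mu_{J-1}^{n,p})\Big),\quad p=1,2,$$ $$\omega_J^{n+1}=\omega_J^n-\frac{\Delta t}{\Delta x}\Big(G(\omega_J^n,\omega_{J+1}^n)-\big(G(\mu_{J-1}^{n,1},\omega_J^n)+G(\mu_{J-1}^{n,2},\omega_J^n)\big)\Big),$$ with boundary conditions, for all $n\ge0$, $\mu_{J-2}^{n,1}=u_\ell$, $\mu_{J-2}^{n,2}=v_\ell$, $\mu_{J+1}^{n,1}=w_r^1$, $\mu_{J+1}^{n,2}=w_r^2$ (so that $\omega_{J+1}^n=w_r$). Then the unique stationary solution $(\bar\mu^1_{J-1},\bar\mu^2_{J-1},\bar\omega_J)$, with $\bar\omega_J=\bar\mu_J^1+\bar\mu_J^2$, is determined by the following conditions. Case (A): if $f(u_\ell)+f(v_\ell)<f(w_r)$, then $\bar\mu^1_{J-1}=u_\ell$, $\bar\mu^2_{J-1}=v_\ell$, and $\bar\omega_J<\sigma$ is such that $f(\bar\omega_J)=f(u_\ell)+f(v_\ell)$. Case (B): if $f(u_\ell)+f(v_\ell)>f(w_r)$ and $f(v_\ell)<\frac{f(w_r)}{2}$,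 then $\bar\mu^1_{J-1}>\sigma$ is such that $f(\bar\mu^1_{J-1})=f(w_r)-f(v_\ell)$, $\bar\mu^2_{J-1}=v_\ell$, and $\bar\omega_J>\sigma$ is such that $f(\bar\omega_J)=f(w_r)-f(v_\ell)$. Case (C): if $f(u_\ell)>\frac{f(w_r)}{2}$ and $f(v_\ell)>\frac{f(w_r)}{2}$, then $\bar\mu^1_{J-1}=\bar\mu^2_{J-1}=\bar\omega_J>\sigma$ is such that $f(\bar\mu^1_{J-1})=f(\bar\mu^2_{J-1})=f(\bar\omega_J)=\frac{f(w_r)}{2}$. Moreover, the individual stationary densities $\bar\mu_J^1,\bar\mu_J^2$ at cell $J$ are given in terms of $\bar\omega_J$ by: Case (A): $\bar\mu_J^1=\frac{f(u_\ell)}{f(u_\ell)+f(v_\ell)}\,\bar\omega_J$ and $\bar\mu_J^2=\bar\omega_J-\bar\mu_J^1$; Case (B): $\bar\mu_J^1=\frac{f(w_r)-f(v_\ell)}{f(w_r)}\,\bar\omega_J$ and $\bar\mu_J^2=\bar\omega_J-\bar\mu_J^1$; Case (C): $\bar\mu_J^1=\bar\mu_J^2=\bar\omega_J/2$.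
   Context: Let $\rho_{\max}>0$ and let $f\in C^0([0,\rho_{\max}])\cap C^1((0,\rho_{\max}))$ be strictly concave with $f(0)=f(\rho_{\max})=0$; let $\sigma:=\arg\max_{(0,\rho_{\max})}f$. All densities take values in $[0,\rho_{\max}]$ (for the cell $J$, the total density $\omega_J$ lies in $[0,\rho_{\max}]$). $\Delta x,\Delta t>0$ are the space and time steps. The Godunov numerical flux is $$G(\rho_\ell,\rho_r):=\begin{cases}\min\{f(\rho_\ell),f(\rho_r)\} & \text{if }\rho_\ell\le\rho_r,\\ f(\rho_\ell) & \text{if }\rho_\ell>\rho_r\text{ and }\rho_\ell<\sigma,\\ f(\sigma) & \text{if }\rho_\ell>\rho_r\text{ and }\rho_\ell\ge\sigma\ge\rho_r,\\ f(\rho_r) & \text{if }\rho_\ell>\rho_r\text{ and }\rho_r>\sigma.\end{cases}$$ Here two incoming roads merge into one outgoing road, $J$ is the first cell of the outgoing road, $\mu_{J-2}^{n,p},\mu_{J-1}^{n,p}$ are the densities in the last two cells of the $p$-th incoming road, $\mu_J^{n,p},\mu_{J+1}^{n,p}$ are the densities in the first two cells of the outgoing road of the vehicles coming from the $p$-th incoming road, $\omega_J^n=\mu_J^{n,1}+\mu_J^{n,2}$ and $\omega_{J+1}^n=\mu_{J+1}^{n,1}+\mu_{J+1}^{n,2}$. The individual densities at cell $J$ evolve according to $$\mu_J^{n+1,p}=\mu_J^{n,p}-\frac{\Delta t}{\Delta x}\left(\frac{\mu_J^{n,p}}{\omega_J^n}G(\omega_J^n,\omega_{J+1}^n)-G(\mu_{J-1}^{n,p},\omega_J^n)\right),\quad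 p=1,2$$ (with $\mu/\omega:=0$ if $\omega=0$), whose sum over $p$ is the equation for $\omega_J^n$. A stationary solution is a fixed point of this discrete dynamical system. *)

theory Defs
  imports "HOL-Analysis.Analysis"
begin

definition strictly_concave_on :: "real set \<Rightarrow> (real \<Rightarrow> real) \<Rightarrow> bool" where
  "strictly_concave_on S f \<longleftrightarrow> convex S \<and>
     (\<forall>x\<in>S. \<forall>y\<in>S. \<forall>t. x \<noteq> y \<and> 0 < t \<and> t < 1 \<longrightarrow>
        (1 - t) * f x + t * f y < f ((1 - t) * x + t * y))"

definition godunov_flux :: "(real \<Rightarrow> real) \<Rightarrow> real \<Rightarrow> real \<Rightarrow> real \<Rightarrow> real" where
  "godunov_flux f \<sigma> \<rho>l \<rho>r =
     (if \<rho>l \<le> \<rho>r then min (f \<rho>l) (f \<rho>r)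
      else if \<rho>l < \<sigma> then f \<rho>l
      else if \<rho>r \<le> \<sigma> then f \<sigma>
      else f \<rho>r)"

text \<open>One time step of the density in cell \<open>J - 1\<close> of an incoming road; \<open>\<mu>'\<close> is the density
  in cell \<open>J - 2\<close> of the same road, \<open>\<omega>\<close> the total density in cell \<open>J\<close>.\<close>

definition incoming_update ::
  "(real \<Rightarrow> real) \<Rightarrow> real \<Rightarrow> real \<Rightarrow> real \<Rightarrow> real \<Rightarrow> real \<Rightarrow> real \<Rightarrow> real" where
  "incoming_update f \<sigma> dx dt \<mu>' \<mu> \<omega> =
     \<mu> - dt / dx * (godunov_flux f \<sigma> \<mu> \<omega> - godunov_flux f \<sigma> \<mu>' \<mu>)"

text \<open>One time step of the total density \<open>\<omega>\<close> in cell \<open>J\<close>; \<open>\<mu>1\<close>, \<open>\<mu>2\<close> are the densities in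
  the cells \<open>J - 1\<close> and \<open>\<omega>'\<close> is the total density in cell \<open>J + 1\<close>.\<close>

definition total_update ::
  "(real \<Rightarrow> real) \<Rightarrow> real \<Rightarrow> real \<Rightarrow> real \<Rightarrow> real \<Rightarrow> real \<Rightarrow> real \<Rightarrow> real \<Rightarrow> real" where
  "total_update f \<sigma> dx dt \<mu>1 \<mu>2 \<omega> \<omega>' =
     \<omega> - dt / dx * (godunov_flux f \<sigma> \<omega> \<omega>'
                      - (godunov_flux f \<sigma> \<mu>1 \<omega> + godunov_flux f \<sigma> \<mu>2 \<omega>))"

text \<open>One time step of the density \<open>\<nu>\<close> in cell \<open>J\<close> of the vehicles coming from one incoming
  road, whose density in cell \<open>J - 1\<close> is \<open>\<mu>\<close>. The convention \<open>\<nu> / \<omega> = 0\<close> for \<open>\<omega> = 0\<close> is the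
  one built into division.\<close>

definition individual_update ::
  "(real \<Rightarrow> real) \<Rightarrow> real \<Rightarrow> real \<Rightarrow> real \<Rightarrow> real \<Rightarrow> real \<Rightarrow> real \<Rightarrow> real \<Rightarrow> real" where
  "individual_update f \<sigma> dx dt \<mu> \<nu> \<omega> \<omega>' =
     \<nu> - dt / dx * (\<nu> / \<omega> * godunov_flux f \<sigma> \<omega> \<omega>' - godunov_flux f \<sigma> \<mu> \<omega>)"

text \<open>The merge scheme with constant boundary data: densities \<open>u\<close>, \<open>v\<close> in the cells \<open>J - 2\<close> of
  the two incoming roads, \<open>w1\<close>, \<open>w2\<close> in cell \<open>J + 1\<close>. Since the boundary data do not depend on
  time, the scheme is the iteration of a single map.\<close>

definition merge_step ::
  "(real \<Rightarrow> real) \<Rightarrow> real \<Rightarrow> real \<Rightarrow> real \<Rightarrow> real \<Rightarrow> real \<Rightarrow> real \<Rightarrow> real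
     \<Rightarrow> real \<times> real \<times> real \<Rightarrow> real \<times> real \<times> real" where
  "merge_step f \<sigma> dx dt u v w1 w2 = (\<lambda>(\<mu>1, \<mu>2, \<omega>).
     (incoming_update f \<sigma> dx dt u \<mu>1 \<omega>,
      incoming_update f \<sigma> dx dt v \<mu>2 \<omega>,
      total_update f \<sigma> dx dt \<mu>1 \<mu>2 \<omega> (w1 + w2)))"

text \<open>The same scheme with cell \<open>J\<close> resolved into the individual densities \<open>\<nu>1\<close>, \<open>\<nu>2\<close>.\<close>

definition merge_step_individual ::
  "(real \<Rightarrow> real) \<Rightarrow> real \<Rightarrow> real \<Rightarrow> real \<Rightarrow> real \<Rightarrow> real \<Rightarrow> real \<Rightarrow> real
     \<Rightarrow> real \<times> real \<times> real \<times> real \<Rightarrow> real \<times> real \<times> real \<times> real" where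
  "merge_step_individual f \<sigma> dx dt u v w1 w2 = (\<lambda>(\<mu>1, \<mu>2, \<nu>1, \<nu>2).
     (incoming_update f \<sigma> dx dt u \<mu>1 (\<nu>1 + \<nu>2),
      incoming_update f \<sigma> dx dt v \<mu>2 (\<nu>1 + \<nu>2),
      individual_update f \<sigma> dx dt \<mu>1 \<nu>1 (\<nu>1 + \<nu>2) (w1 + w2),
      individual_update f \<sigma> dx dt \<mu>2 \<nu>2 (\<nu>1 + \<nu>2) (w1 + w2)))"

text \<open>Stationary solutions are sought among admissible densities only, i.e. those with values
  in \<open>[0, \<rho>max]\<close>; nothing is assumed about \<open>f\<close> outside this interval.\<close>

definition merge_stationary ::
  "(real \<Rightarrow> real) \<Rightarrow> real \<Rightarrow> real \<Rightarrow> real \<Rightarrow> real \<Rightarrow> real \<Rightarrow> real \<Rightarrow> real \<Rightarrow> real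
     \<Rightarrow> real \<times> real \<times> real \<Rightarrow> bool" where
  "merge_stationary f \<rho>max \<sigma> dx dt u v w1 w2 s \<longleftrightarrow>
     s \<in> {0..\<rho>max} \<times> {0..\<rho>max} \<times> {0..\<rho>max} \<and>
     merge_step f \<sigma> dx dt u v w1 w2 s = s"

definition merge_stationary_individual ::
  "(real \<Rightarrow> real) \<Rightarrow> real \<Rightarrow> real \<Rightarrow> real \<Rightarrow> real \<Rightarrow> real \<Rightarrow> real \<Rightarrow> real \<Rightarrow> real
     \<Rightarrow> real \<times> real \<times> real \<times> real \<Rightarrow> bool" where
  "merge_stationary_individual f \<rho>max \<sigma> dx dt u v w1 w2 s \<longleftrightarrow>
     s \<in> {(\<mu>1, \<mu>2, \<nu>1, \<nu>2). \<mu>1 \<in> {0..\<rho>max} \<and> \<mu>2 \<in> {0..\<rho>max} \<and>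
            \<nu>1 \<in> {0..\<rho>max} \<and> \<nu>2 \<in> {0..\<rho>max} \<and> \<nu>1 + \<nu>2 \<in> {0..\<rho>max}} \<and>
     merge_step_individual f \<sigma> dx dt u v w1 w2 s = s"

end

(*
  On [0, R] the Godunov flux G l r equals min (f (min l \<sigma>)) (f (max r \<sigma>)), the minimum of the
  demand of the left cell and the supply of the right cell. Hence in a stationary solution the flux
  out of an incoming road is min (f u) S, where S = f (max \<omega> \<sigma>); unless f u = S, this forces
  \<mu> = u (free flow) or \<mu> = \<omega> (congestion). It remains to solve
  min (f u) S + min (f v) S = min (f (min \<omega> \<sigma>)) (f w) for \<omega>; the three cases exclude the
  degenerate equalities. The individual densities split \<omega> in proportion to the two incoming fluxes.
*)
theory Submission
  imports Defs
begin

section \<open>From strict concavity to a unimodal flux function\<close>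

text \<open>The middle point is a proper convex combination of the outer ones, and the same
  combination of \<open>f x\<close> and \<open>f z\<close> is at least their minimum.\<close>

lemma strictly_concave_onD:
  assumes "strictly_concave_on S f" "x \<in> S" "z \<in> S" "x < y" "y < z"
  shows "min (f x) (f z) < f y"
proof -
  define t where "t = (y - x) / (z - x)"
  have "t * (z - x) = y - x"
    using assms by (simp add: t_def)
  then have "y = (1 - t) * x + t * z"
    by (simp add: algebra_simps)
  moreover have "0 < t" "t < 1"
    using assms by (simp_all add: t_def)
  ultimately have t: "0 < t" "t < 1" "y = (1 - t) * x + t * z"
    by blast+
  have "(1 - t) * f x + t * f z < f y"
    using assms t unfolding strictly_concave_on_def by force
  moreover have "min (f x) (f z) \<le> (1 - t) * f x + t * f z"
  proof -
    have "(1 - t) * min (f x) (f z) + t * min (f x) (f z) \<le> (1 - t) * f x + t * f z"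
      using t by (intro add_mono mult_left_mono) auto
    then show ?thesis
      by (simp add: algebra_simps)
  qed
  ultimately show ?thesis
    by linarith
qed

text \<open>The shape of the flux function that drives the later arguments: two injective branches
  which, by continuity, both attain every value from 0 to \<open>f \<sigma>\<close>.\<close>

locale unimodal_flux =
  fixes f :: "real \<Rightarrow> real" and R \<sigma> :: real
  assumes \<sigma>: "0 < \<sigma>" "\<sigma> < R"
    and cont: "continuous_on {0..R} f"
    and f_0: "f 0 = 0" and f_R: "f R = 0"
    and incr: "\<And>x y. 0 \<le> x \<Longrightarrow> x < y \<Longrightarrow> y \<le> \<sigma> \<Longrightarrow> f x < f y"
    and decr: "\<And>x y. \<sigma> \<le> x \<Longrightarrow> x < y \<Longrightarrow> y \<le> R \<Longrightarrow> f y < f x"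

text \<open>Since \<open>f\<close> is positive inside the interval, its maximum is attained in the
  interior. A second maximiser would be beaten by the midpoint. A point strictly between
  \<open>x\<close> and \<open>\<sigma>\<close> has a value above the smaller of \<open>f x\<close>
  and \<open>f \<sigma>\<close>, which can only be \<open>f x\<close>; this gives monotonicity on
  either side of \<open>\<sigma>\<close>.\<close>

lemma unimodal_flux_arg_max:
  assumes "R > 0" and cont: "continuous_on {0..R} f" and conc: "strictly_concave_on {0..R} f"
    and f0: "f 0 = 0" "f R = 0" and \<sigma>: "\<sigma> = arg_max_on f {0<..<R}"
  shows "unimodal_flux f R \<sigma>"
proof -
  have pos: "0 < f x" if "0 < x" "x < R" for x
    using strictly_concave_onD[OF conc, of 0 R x] that f0 \<open>R > 0\<close> by simp
  obtain m where m: "m \<in> {0..R}" "\<And>x. x \<in> {0..R} \<Longrightarrow> f x \<le> f m"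
    using continuous_attains_sup[OF _ _ cont] \<open>R > 0\<close> by fastforce
  have "f (R / 2) > 0" "f (R / 2) \<le> f m"
    using pos[of "R / 2"] m(2)[of "R / 2"] \<open>R > 0\<close> by auto
  then have "m \<noteq> 0" "m \<noteq> R"
    using f0 by auto
  then have "is_arg_max f (\<lambda>x. x \<in> {0<..<R}) m"
    using m by (auto simp: is_arg_max_linorder)
  \<comment> \<open>\<open>arg_max_on\<close> is a choice operator, so its defining property follows
    from the existence of a maximiser, here \<open>m\<close>.\<close>
  then have "is_arg_max f (\<lambda>x. x \<in> {0<..<R}) \<sigma>"
    unfolding \<sigma> arg_max_on_def arg_max_def by (rule someI)
  then have \<sigma>_in: "0 < \<sigma>" "\<sigma> < R" and "\<And>x. x \<in> {0<..<R} \<Longrightarrow> f x \<le> f \<sigma>"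
    by (auto simp: is_arg_max_linorder)
  then have max: "f x \<le> f \<sigma>" if "x \<in> {0..R}" for x
    using that f0 pos[of \<sigma>] by (cases "x = 0 \<or> x = R") (auto intro: less_imp_le)
  have neq: "f y \<noteq> f \<sigma>" if "y \<in> {0..R}" "y \<noteq> \<sigma>" for y
  proof
    assume eq: "f y = f \<sigma>"
    define m where "m = (y + \<sigma>) / 2"
    have "min (f y) (f \<sigma>) < f m"
    proof (cases "y < \<sigma>")
      case True
      then show ?thesis
        using strictly_concave_onD[OF conc, of y \<sigma> m] that \<sigma>_in by (auto simp: m_def)
    next
      case False
      then show ?thesis
        using strictly_concave_onD[OF conc, of \<sigma> y m] that \<sigma>_in by (auto simp: m_def min.commute)
    qed
    moreover have "f m \<le> f \<sigma>"
      using that \<sigma>_in by (intro max) (auto simp: m_def)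
    ultimately show False
      using eq by simp
  qed
  show ?thesis
  proof
    show "f x < f y" if "0 \<le> x" "x < y" "y \<le> \<sigma>" for x y
    proof (cases "y = \<sigma>")
      case True
      then show ?thesis
        using max[of x] neq[of x] that \<sigma>_in by force
    next
      case False
      then have "min (f x) (f \<sigma>) < f y"
        using strictly_concave_onD[OF conc, of x \<sigma> y] that \<sigma>_in by simp
      then show ?thesis
        using max[of y] that \<sigma>_in by (auto simp: min_def split: if_splits)
    qed
    show "f y < f x" if "\<sigma> \<le> x" "x < y" "y \<le> R" for x y
    proof (cases "x = \<sigma>")
      case True
      then show ?thesis
        using max[of y] neq[of y] that \<sigma>_in by force
    next
      case False
      then have "min (f \<sigma>) (f y) < f x"
        using strictly_concave_onD[OF conc, of \<sigma> y x] that \<sigma>_in by simp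
      then show ?thesis
        using max[of x] that \<sigma>_in by (auto simp: min_def split: if_splits)
    qed
  qed (use \<sigma>_in cont f0 in auto)
qed

section \<open>The Godunov flux in terms of demand and supply, and the balance of an incoming
  road\<close>

context unimodal_flux
begin

abbreviation G :: "real \<Rightarrow> real \<Rightarrow> real" where
  "G \<equiv> godunov_flux f \<sigma>"

text \<open>The sending function of the cell transmission model: the largest flux that a cell of
  density \<open>x\<close> can emit.\<close>

definition flux_demand :: "real \<Rightarrow> real" where
  "flux_demand x = f (min x \<sigma>)"

text \<open>The receiving function: the largest flux that a cell of density \<open>x\<close> can
  take in.\<close>

definition flux_supply :: "real \<Rightarrow> real" where
  "flux_supply x = f (max x \<sigma>)"

lemma incr_iff:
  assumes "x \<in> {0..\<sigma>}" "y \<in> {0..\<sigma>}"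
  shows "f x < f y \<longleftrightarrow> x < y" "f x \<le> f y \<longleftrightarrow> x \<le> y" "f x = f y \<longleftrightarrow> x = y"
  using assms incr[of x y] incr[of y x] by (cases x y rule: linorder_cases; auto)+

lemma decr_iff:
  assumes "x \<in> {\<sigma>..R}" "y \<in> {\<sigma>..R}"
  shows "f x < f y \<longleftrightarrow> y < x" "f x \<le> f y \<longleftrightarrow> y \<le> x" "f x = f y \<longleftrightarrow> x = y"
  using assms decr[of x y] decr[of y x] by (cases x y rule: linorder_cases; auto)+

lemma f_le_max: "x \<in> {0..R} \<Longrightarrow> f x \<le> f \<sigma>"
  using incr_iff(2)[of x \<sigma>] decr_iff(2)[of x \<sigma>] \<sigma> by (cases "x \<le> \<sigma>") auto

lemma f_pos: "x \<in> {0<..<R} \<Longrightarrow> 0 < f x"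
  using incr[of 0 x] decr[of x R] f_0 f_R \<sigma> by (cases "x \<le> \<sigma>") auto

lemma f_nonneg: "x \<in> {0..R} \<Longrightarrow> 0 \<le> f x"
  using f_pos[of x] f_0 f_R by (cases "x = 0 \<or> x = R") auto

text \<open>If the densities lie on different sides of \<open>\<sigma>\<close>, both formulas agree
  by unfolding. On a common branch, monotonicity of \<open>f\<close> there and maximality of
  \<open>f \<sigma>\<close> decide the minima.\<close>

lemma godunov_flux_eq_min:
  assumes "x \<in> {0..R}" "y \<in> {0..R}"
  shows "G x y = min (flux_demand x) (flux_supply y)"
proof (cases "x \<le> \<sigma>"; cases "y \<le> \<sigma>")
  assume "x \<le> \<sigma>" "y \<le> \<sigma>"
  then show ?thesis
    using assms incr_iff(2)[of x y] f_le_max[of x]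
    by (auto simp: godunov_flux_def flux_demand_def flux_supply_def min_def max_def)
next
  assume "x \<le> \<sigma>" "\<not> y \<le> \<sigma>"
  then show ?thesis
    by (auto simp: godunov_flux_def flux_demand_def flux_supply_def min_def max_def)
next
  assume "\<not> x \<le> \<sigma>" "y \<le> \<sigma>"
  then show ?thesis
    by (auto simp: godunov_flux_def flux_demand_def flux_supply_def min_def max_def)
next
  assume "\<not> x \<le> \<sigma>" "\<not> y \<le> \<sigma>"
  then show ?thesis
    using assms decr_iff(2)[of y x] f_le_max[of y]
    by (auto simp: godunov_flux_def flux_demand_def flux_supply_def min_def max_def)
qed

text \<open>If \<open>\<mu> \<le> \<sigma>\<close>, its supply is \<open>f \<sigma>\<close>, so the
  common flux is \<open>f u\<close>, and as outflow it is at most the supply of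
  \<open>\<omega>\<close>. If \<open>\<mu> > \<sigma>\<close>, its demand is
  \<open>f \<sigma>\<close>, so the common flux is the supply of \<open>\<omega>\<close>, and as
  inflow it is at most \<open>f u\<close>.\<close>

lemma incoming_flux:
  assumes "u \<in> {0<..<\<sigma>}" "\<mu> \<in> {0..R}" "\<omega> \<in> {0..R}" and eq: "G \<mu> \<omega> = G u \<mu>"
  shows "G u \<mu> = min (f u) (flux_supply \<omega>)"
proof -
  have "u \<in> {0..R}" "flux_demand u = f u" "f u \<le> f \<sigma>"
    using assms \<sigma> f_le_max[of u] by (auto simp: flux_demand_def)
  moreover have "flux_supply \<omega> \<le> f \<sigma>"
    using assms \<sigma> by (auto simp: flux_supply_def intro!: f_le_max)
  ultimately show ?thesis
    using assms eq godunov_flux_eq_min[of \<mu> \<omega>] godunov_flux_eq_min[of u \<mu>]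
    by (cases "\<mu> \<le> \<sigma>") (auto simp: flux_demand_def flux_supply_def min_def max_def split: if_splits)
qed

text \<open>The flux is \<open>f u\<close>, below the supply of \<open>\<omega>\<close>, so it must
  be the demand of \<open>\<mu>\<close>; being less than \<open>f \<sigma>\<close>, it determines
  \<open>\<mu>\<close> on the increasing branch. Strictness matters: if \<open>f u\<close> were
  equal to the supply, every \<open>\<mu>\<close> from \<open>u\<close> to \<open>\<omega>\<close>
  would balance the fluxes.\<close>

lemma incoming_free_iff:
  assumes "u \<in> {0<..<\<sigma>}" "\<mu> \<in> {0..R}" "\<omega> \<in> {0..R}" and less: "f u < flux_supply \<omega>"
  shows "G \<mu> \<omega> = G u \<mu> \<longleftrightarrow> \<mu> = u"
proof
  have u: "u \<in> {0..R}" "flux_demand u = f u" "flux_supply u = f \<sigma>" "f u < f \<sigma>"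
    using assms \<sigma> incr[of u \<sigma>] by (auto simp: flux_demand_def flux_supply_def)
  show "\<mu> = u" if eq: "G \<mu> \<omega> = G u \<mu>"
  proof -
    have "min (flux_demand \<mu>) (flux_supply \<omega>) = f u"
      using incoming_flux[OF assms(1-3) eq] eq less godunov_flux_eq_min[OF assms(2,3)] by simp
    then have "flux_demand \<mu> = f u"
      using less by (simp add: min_def split: if_splits)
    then show ?thesis
      using assms u incr_iff(3)[of \<mu> u] by (auto simp: flux_demand_def min_def split: if_splits)
  qed
  show "G \<mu> \<omega> = G u \<mu>" if "\<mu> = u"
    using that assms u godunov_flux_eq_min[of u \<omega>] godunov_flux_eq_min[of u u] by auto
qed

text \<open>A supply below \<open>f u < f \<sigma>\<close> puts \<open>\<omega>\<close> on the
  decreasing branch. The flux is then \<open>f \<omega>\<close>, which is less than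
  \<open>f u\<close> and hence must be the supply of \<open>\<mu>\<close>; injectivity of that
  branch gives \<open>\<mu> = \<omega>\<close>.\<close>

lemma incoming_congested_iff:
  assumes "u \<in> {0<..<\<sigma>}" "\<mu> \<in> {0..R}" "\<omega> \<in> {0..R}" and less: "flux_supply \<omega> < f u"
  shows "G \<mu> \<omega> = G u \<mu> \<longleftrightarrow> \<mu> = \<omega>"
proof
  have u: "u \<in> {0..R}" "flux_demand u = f u" "f u < f \<sigma>"
    using assms \<sigma> incr[of u \<sigma>] by (auto simp: flux_demand_def flux_supply_def)
  have \<omega>: "\<omega> > \<sigma>" "flux_supply \<omega> = f \<omega>"
    using less u by (auto simp: flux_supply_def max_def split: if_splits)
  show "\<mu> = \<omega>" if eq: "G \<mu> \<omega> = G u \<mu>"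
  proof -
    have "min (f u) (flux_supply \<mu>) = f \<omega>"
      using incoming_flux[OF assms(1-3) eq] less \<omega> u godunov_flux_eq_min[of u \<mu>] assms by simp
    then have "flux_supply \<mu> = f \<omega>"
      using less \<omega> by (simp add: min_def split: if_splits)
    then show ?thesis
      using assms u \<omega> decr_iff(3)[of \<mu> \<omega>] by (auto simp: flux_supply_def max_def split: if_splits)
  qed
  show "G \<mu> \<omega> = G u \<mu>" if "\<mu> = \<omega>"
    using that assms u \<omega> godunov_flux_eq_min[of \<omega> \<omega>] godunov_flux_eq_min[of u \<omega>]
    by (auto simp: flux_demand_def)
qed

text \<open>Existence is the intermediate value theorem, uniqueness strict monotonicity;
  \<open>y < f \<sigma>\<close> excludes the end point \<open>\<sigma>\<close>.\<close>

lemma ex1_increasing_branch: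
  assumes "0 \<le> y" "y < f \<sigma>"
  shows "\<exists>!x. x \<in> {0..<\<sigma>} \<and> f x = y"
proof -
  have "\<exists>x\<ge>0. x \<le> \<sigma> \<and> f x = y"
    using assms \<sigma> f_0 by (intro IVT') (auto intro: continuous_on_subset[OF cont])
  then obtain x where "x \<in> {0..\<sigma>}" "f x = y"
    by auto
  then show ?thesis
    using assms incr_iff(3) by (intro ex1I[of _ x]) force+
qed

lemma ex1_decreasing_branch:
  assumes "0 \<le> y" "y < f \<sigma>"
  shows "\<exists>!x. x \<in> {\<sigma><..R} \<and> f x = y"
proof -
  have "\<exists>x\<ge>\<sigma>. x \<le> R \<and> f x = y"
    using assms \<sigma> f_R by (intro IVT2') (auto intro: continuous_on_subset[OF cont])
  then obtain x where "x \<in> {\<sigma>..R}" "f x = y"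
    by auto
  then show ?thesis
    using assms decr_iff(3) by (intro ex1I[of _ x]) force+
qed

end

section \<open>Stationarity of the merge scheme as balance of fluxes\<close>

locale merge_scheme = unimodal_flux +
  fixes dx dt u v w1 w2 w :: real
  assumes dx: "dx > 0" and dt: "dt > 0"
    and u: "u \<in> {0<..<\<sigma>}" and v: "v \<in> {0<..<\<sigma>}"
    and w_eq: "w = w1 + w2" and w: "w \<in> {\<sigma><..<R}"
begin

abbreviation "stationary \<equiv> merge_stationary f R \<sigma> dx dt u v w1 w2"
abbreviation "stationary_individual \<equiv> merge_stationary_individual f R \<sigma> dx dt u v w1 w2"

text \<open>As \<open>dt / dx\<close> is nonzero, a cell is left unchanged exactly when its inflow
  equals its outflow.\<close>

lemma stationary_iff:
  "stationary (\<mu>1, \<mu>2, \<omega>) \<longleftrightarrow> \<mu>1 \<in> {0..R} \<and> \<mu>2 \<in> {0..R} \<and> \<omega> \<in> {0..R} \<and>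
     G \<mu>1 \<omega> = G u \<mu>1 \<and> G \<mu>2 \<omega> = G v \<mu>2 \<and> G \<omega> w = G \<mu>1 \<omega> + G \<mu>2 \<omega>"
  using dx dt
  by (auto simp: merge_stationary_def merge_step_def incoming_update_def total_update_def w_eq)

lemma stationary_individual_iff_flux:
  "stationary_individual (\<mu>1, \<mu>2, \<nu>1, \<nu>2) \<longleftrightarrow> \<mu>1 \<in> {0..R} \<and> \<mu>2 \<in> {0..R} \<and>
     \<nu>1 \<in> {0..R} \<and> \<nu>2 \<in> {0..R} \<and> \<nu>1 + \<nu>2 \<in> {0..R} \<and>
     G \<mu>1 (\<nu>1 + \<nu>2) = G u \<mu>1 \<and> G \<mu>2 (\<nu>1 + \<nu>2) = G v \<mu>2 \<and>
     \<nu>1 / (\<nu>1 + \<nu>2) * G (\<nu>1 + \<nu>2) w = G \<mu>1 (\<nu>1 + \<nu>2) \<and>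
     \<nu>2 / (\<nu>1 + \<nu>2) * G (\<nu>1 + \<nu>2) w = G \<mu>2 (\<nu>1 + \<nu>2)"
  using dx dt
  by (auto simp: merge_stationary_individual_def merge_step_individual_def incoming_update_def
      individual_update_def w_eq)

lemma f_w: "0 < f w" "f w < f \<sigma>"
  using f_pos[of w] decr[of \<sigma> w] w \<sigma> by auto

lemma f_uv: "0 < f u" "0 < f v" "f u < f \<sigma>" "f v < f \<sigma>"
  using f_pos[of u] f_pos[of v] incr[of u \<sigma>] incr[of v \<sigma>] u v \<sigma> by auto

lemma outgoing_flux: "\<omega> \<in> {0..R} \<Longrightarrow> G \<omega> w = min (flux_demand \<omega>) (f w)"
  using godunov_flux_eq_min[of \<omega> w] w \<sigma> by (auto simp: flux_supply_def)

lemma godunov_flux_nonneg: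
  assumes "x \<in> {0..R}" "y \<in> {0..R}"
  shows "0 \<le> G x y"
  using godunov_flux_eq_min[OF assms] f_nonneg[of "min x \<sigma>"] f_nonneg[of "max y \<sigma>"] assms \<sigma>
  by (auto simp: flux_demand_def flux_supply_def)

text \<open>An empty cell \<open>J\<close> would have full supply \<open>f \<sigma>\<close> and
  receive \<open>f u + f v > 0\<close> while emitting nothing. Positivity justifies the later
  divisions by \<open>\<omega>\<close> and by the outflow.\<close>

lemma stationary_pos:
  assumes "stationary (\<mu>1, \<mu>2, \<omega>)"
  shows "0 < \<omega>" "0 < G \<omega> w"
proof -
  have st: "\<mu>1 \<in> {0..R}" "\<mu>2 \<in> {0..R}" "\<omega> \<in> {0..R}"
    "G \<mu>1 \<omega> = G u \<mu>1" "G \<mu>2 \<omega> = G v \<mu>2" "G \<omega> w = G \<mu>1 \<omega> + G \<mu>2 \<omega>"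
    using assms by (simp_all add: stationary_iff)
  show "0 < \<omega>"
  proof (rule ccontr)
    assume "\<not> 0 < \<omega>"
    then have [simp]: "\<omega> = 0"
      using st by auto
    have "min (f u) (f \<sigma>) + min (f v) (f \<sigma>) = 0"
      using st incoming_flux[OF u st(1,3,4)] incoming_flux[OF v st(2,3,5)] outgoing_flux[of \<omega>] \<sigma> f_0 f_w
      by (simp add: flux_supply_def flux_demand_def)
    then show False
      using f_uv by simp
  qed
  then show "0 < G \<omega> w"
    using f_w outgoing_flux[OF st(3)] f_pos[of "min \<omega> \<sigma>"] st \<sigma> by (auto simp: flux_demand_def)
qed

section \<open>Individual densities in cell \<open>J\<close>\<close>

text \<open>Adding the two individual balances gives the balance of the total. Conversely, each
  individual balance says that the share of a road in \<open>\<omega>\<close> is its share in the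
  total flux.\<close>

lemma stationary_individual_iff:
  "stationary_individual (\<mu>1, \<mu>2, \<nu>1, \<nu>2) \<longleftrightarrow>
     (\<exists>\<omega>. stationary (\<mu>1, \<mu>2, \<omega>) \<and> \<nu>1 = G u \<mu>1 / G \<omega> w * \<omega> \<and> \<nu>2 = \<omega> - \<nu>1)"
  (is "?L \<longleftrightarrow> ?R")
proof
  assume L: ?L
  define \<omega> where "\<omega> = \<nu>1 + \<nu>2"
  note fl = L[unfolded stationary_individual_iff_flux, folded \<omega>_def]
  have "G \<omega> w = G \<mu>1 \<omega> + G \<mu>2 \<omega>"
  \<comment> \<open>Positivity of \<open>\<omega>\<close> is a consequence of the stationarity still
    to be shown. For \<open>\<omega> = 0\<close> the quotients vanish by convention, and so does the
    outflow of the empty cell.\<close>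
  proof (cases "\<omega> = 0")
    case True
    then show ?thesis
      using fl outgoing_flux[of 0] f_w f_0 \<sigma> by (auto simp: flux_demand_def)
  next
    case False
    have "G \<mu>1 \<omega> + G \<mu>2 \<omega> = (\<nu>1 + \<nu>2) / \<omega> * G \<omega> w"
      using fl by (simp add: add_divide_distrib algebra_simps)
    then show ?thesis
      using False by (simp add: \<omega>_def)
  qed
  then have st: "stationary (\<mu>1, \<mu>2, \<omega>)"
    using fl by (simp add: stationary_iff)
  then have "\<nu>1 = G u \<mu>1 / G \<omega> w * \<omega>"
    using fl stationary_pos[OF st] by (auto simp: field_simps)
  then show ?R
    using st by (auto simp: \<omega>_def)
next
  assume ?R
  then obtain \<omega> where st: "stationary (\<mu>1, \<mu>2, \<omega>)"
    and \<nu>1: "\<nu>1 = G u \<mu>1 / G \<omega> w * \<omega>" and \<nu>2: "\<nu>2 = \<omega> - \<nu>1"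
    by auto
  note fl = st[unfolded stationary_iff]
  note pos = stationary_pos[OF st]
  \<comment> \<open>By the total balance, the remainder of \<open>\<omega>\<close> is exactly the
    share of the second road.\<close>
  have \<nu>2': "\<nu>2 = G v \<mu>2 / G \<omega> w * \<omega>"
    using fl pos by (simp add: \<nu>2 \<nu>1 field_simps)
  have "0 \<le> G u \<mu>1" "0 \<le> G v \<mu>2"
    using fl godunov_flux_nonneg[of u \<mu>1] godunov_flux_nonneg[of v \<mu>2] u v \<sigma> by auto
  then have "0 \<le> \<nu>1" "0 \<le> \<nu>2"
    using pos by (auto simp: \<nu>1 \<nu>2' intro!: mult_nonneg_nonneg divide_nonneg_pos)
  moreover have "\<nu>1 / \<omega> * G \<omega> w = G u \<mu>1" "\<nu>2 / \<omega> * G \<omega> w = G v \<mu>2"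
    using pos by (auto simp: \<nu>1 \<nu>2')
  moreover have "\<nu>1 + \<nu>2 = \<omega>"
    by (simp add: \<nu>2)
  ultimately show ?L
    using fl unfolding stationary_individual_iff_flux by auto
qed

lemma ex1_stationary_individual:
  assumes "\<exists>!s. stationary s"
  shows "\<exists>!s. stationary_individual s"
proof -
  obtain \<mu>1 \<mu>2 \<omega> where st: "stationary (\<mu>1, \<mu>2, \<omega>)"
    using assms by (metis prod_cases3)
  have uniq: "a = \<mu>1 \<and> b = \<mu>2 \<and> c = \<omega>" if "stationary (a, b, c)" for a b c
    using assms st that by blast
  show ?thesis
  proof (rule ex1I)
    let ?\<nu> = "G u \<mu>1 / G \<omega> w * \<omega>"
    show "stationary_individual (\<mu>1, \<mu>2, ?\<nu>, \<omega> - ?\<nu>)"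
      using st stationary_individual_iff by blast
    fix s assume "stationary_individual s"
    then show "s = (\<mu>1, \<mu>2, ?\<nu>, \<omega> - ?\<nu>)"
      using uniq by (cases s) (auto simp: stationary_individual_iff)
  qed
qed

section \<open>The three traffic regimes\<close>

text \<open>Here cell \<open>J\<close> has supply \<open>f \<sigma>\<close>, above both
  \<open>f u\<close> and \<open>f v\<close>, so both roads flow freely.\<close>

lemma stationary_uncongestedD:
  assumes "stationary (\<mu>1, \<mu>2, \<omega>)" "\<omega> \<le> \<sigma>"
  shows "f u + f v = min (f \<omega>) (f w)" "\<mu>1 = u" "\<mu>2 = v"
proof -
  have st: "\<mu>1 \<in> {0..R}" "\<mu>2 \<in> {0..R}" "\<omega> \<in> {0..R}"
    "G \<mu>1 \<omega> = G u \<mu>1" "G \<mu>2 \<omega> = G v \<mu>2" "G \<omega> w = G \<mu>1 \<omega> + G \<mu>2 \<omega>"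
    using assms by (simp_all add: stationary_iff)
  have sup: "flux_supply \<omega> = f \<sigma>" "flux_demand \<omega> = f \<omega>"
    using assms by (simp_all add: flux_supply_def flux_demand_def)
  show "f u + f v = min (f \<omega>) (f w)"
    using st sup f_uv incoming_flux[OF u st(1,3,4)] incoming_flux[OF v st(2,3,5)]
      outgoing_flux[OF st(3)] by simp
  show "\<mu>1 = u" "\<mu>2 = v"
    using st sup f_uv incoming_free_iff[OF u st(1,3)] incoming_free_iff[OF v st(2,3)] by simp_all
qed

text \<open>Here cell \<open>J\<close> has demand \<open>f \<sigma> > f w\<close>, so its outflow is
  the supply \<open>f w\<close> of cell \<open>J + 1\<close>.\<close>

lemma stationary_congestedD:
  assumes "stationary (\<mu>1, \<mu>2, \<omega>)" "\<sigma> < \<omega>"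
  shows "f w = min (f u) (f \<omega>) + min (f v) (f \<omega>)"
proof -
  have st: "\<mu>1 \<in> {0..R}" "\<mu>2 \<in> {0..R}" "\<omega> \<in> {0..R}"
    "G \<mu>1 \<omega> = G u \<mu>1" "G \<mu>2 \<omega> = G v \<mu>2" "G \<omega> w = G \<mu>1 \<omega> + G \<mu>2 \<omega>"
    using assms by (simp_all add: stationary_iff)
  have sup: "flux_supply \<omega> = f \<omega>" "flux_demand \<omega> = f \<sigma>"
    using assms by (simp_all add: flux_supply_def flux_demand_def)
  show ?thesis
    using st sup f_w incoming_flux[OF u st(1,3,4)] incoming_flux[OF v st(2,3,5)]
      outgoing_flux[OF st(3)] by simp
qed

lemma stationary_fluxes:
  assumes "stationary (\<mu>1, \<mu>2, \<omega>)"
  shows "G u \<mu>1 = min (f u) (flux_supply \<omega>)" "G \<omega> w = min (f u) (flux_supply \<omega>) + min (f v) (flux_supply \<omega>)"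
proof -
  have st: "\<mu>1 \<in> {0..R}" "\<mu>2 \<in> {0..R}" "\<omega> \<in> {0..R}"
    "G \<mu>1 \<omega> = G u \<mu>1" "G \<mu>2 \<omega> = G v \<mu>2" "G \<omega> w = G \<mu>1 \<omega> + G \<mu>2 \<omega>"
    using assms by (simp_all add: stationary_iff)
  show "G u \<mu>1 = min (f u) (flux_supply \<omega>)" "G \<omega> w = min (f u) (flux_supply \<omega>) + min (f v) (flux_supply \<omega>)"
    using st incoming_flux[OF u st(1,3,4)] incoming_flux[OF v st(2,3,5)] by simp_all
qed

text \<open>Reduces the individual densities to a computation of the flux share \<open>r\<close>
  from the supply of cell \<open>J\<close> alone.\<close>

lemma stationary_individual_iff_ratio:
  assumes "\<And>\<mu>1 \<mu>2 \<omega>. stationary (\<mu>1, \<mu>2, \<omega>) \<Longrightarrow>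
    min (f u) (flux_supply \<omega>) / (min (f u) (flux_supply \<omega>) + min (f v) (flux_supply \<omega>)) = r"
  shows "stationary_individual (\<mu>1, \<mu>2, \<nu>1, \<nu>2) \<longleftrightarrow>
    (\<exists>\<omega>. stationary (\<mu>1, \<mu>2, \<omega>) \<and> \<nu>1 = r * \<omega> \<and> \<nu>2 = \<omega> - \<nu>1)"
proof -
  have "G u \<mu>1 / G \<omega> w = r" if "stationary (\<mu>1, \<mu>2, \<omega>)" for \<omega>
    using assms[OF that] stationary_fluxes[OF that] by simp
  then show ?thesis
    unfolding stationary_individual_iff by (metis (no_types))
qed

text \<open>If cell \<open>J\<close> were congested, its outflow \<open>f w\<close> would exceed the
  largest possible inflow \<open>f u + f v\<close>. Hence \<open>\<omega>\<close> lies on the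
  increasing branch, where its flux determines it.\<close>

lemma free_flow:
  assumes less: "f u + f v < f w"
  shows "stationary (\<mu>1, \<mu>2, \<omega>) \<longleftrightarrow> \<mu>1 = u \<and> \<mu>2 = v \<and> \<omega> \<in> {0..<\<sigma>} \<and> f \<omega> = f u + f v"
    and "\<exists>!s. stationary s"
    and "stationary_individual (\<mu>1, \<mu>2, \<nu>1, \<nu>2) \<longleftrightarrow>
      (\<exists>\<omega>. stationary (\<mu>1, \<mu>2, \<omega>) \<and> \<nu>1 = f u / (f u + f v) * \<omega> \<and> \<nu>2 = \<omega> - \<nu>1)"
proof -
  show iff: "stationary (\<mu>1, \<mu>2, \<omega>) \<longleftrightarrow>
      \<mu>1 = u \<and> \<mu>2 = v \<and> \<omega> \<in> {0..<\<sigma>} \<and> f \<omega> = f u + f v" (is "?L \<longleftrightarrow> ?R") for \<mu>1 \<mu>2 \<omega>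
  proof
    assume L: ?L
    have le: "\<omega> \<le> \<sigma>"
    proof (rule ccontr)
      assume "\<not> \<omega> \<le> \<sigma>"
      then show False
        using stationary_congestedD[OF L] less by simp
    qed
    have "f \<omega> = f u + f v"
      using stationary_uncongestedD(1)[OF L le] less by (simp add: min_def split: if_splits)
    moreover from this have "\<omega> \<noteq> \<sigma>"
      using less f_w by auto
    ultimately show ?R
      using stationary_uncongestedD[OF L le] stationary_pos(1)[OF L] le by auto
  next
    assume R: ?R
    then have *: "\<omega> \<in> {0..R}" "u \<in> {0..R}" "v \<in> {0..R}" "flux_supply \<omega> = f \<sigma>" "flux_demand \<omega> = f \<omega>"
      using \<sigma> u v by (auto simp: flux_supply_def flux_demand_def)
    have eqs: "G u \<omega> = G u u" "G v \<omega> = G v v"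
      using incoming_free_iff[OF u *(2,1)] incoming_free_iff[OF v *(3,1)] * f_uv by simp_all
    have "G u u = f u" "G v v = f v"
      using incoming_flux[OF u *(2,1) eqs(1)] incoming_flux[OF v *(3,1) eqs(2)] * f_uv by simp_all
    then show ?L
      using R * eqs less outgoing_flux[OF *(1)] by (auto simp: stationary_iff)
  qed
  have "\<exists>!\<omega>. \<omega> \<in> {0..<\<sigma>} \<and> f \<omega> = f u + f v"
    using less f_w f_uv by (intro ex1_increasing_branch) auto
  then show "\<exists>!s. stationary s"
    by (auto simp: iff Ex1_def)
  show "stationary_individual (\<mu>1, \<mu>2, \<nu>1, \<nu>2) \<longleftrightarrow>
      (\<exists>\<omega>. stationary (\<mu>1, \<mu>2, \<omega>) \<and> \<nu>1 = f u / (f u + f v) * \<omega> \<and> \<nu>2 = \<omega> - \<nu>1)"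
    using f_uv by (intro stationary_individual_iff_ratio) (auto simp: iff flux_supply_def)
qed

text \<open>An uncongested cell \<open>J\<close> would emit \<open>f u + f v\<close>, more than the
  \<open>f w\<close> that cell \<open>J + 1\<close> accepts. In the congested state
  \<open>f v < f w - f v = f \<omega> < f u\<close>, both inequalities strict, so the second road is
  free and the first congested.\<close>

lemma one_road_congested:
  assumes gr: "f u + f v > f w" and less: "f v < f w / 2"
  shows "stationary (\<mu>1, \<mu>2, \<omega>) \<longleftrightarrow> \<mu>1 \<in> {\<sigma><..R} \<and> f \<mu>1 = f w - f v \<and> \<mu>2 = v \<and>
      \<omega> \<in> {\<sigma><..R} \<and> f \<omega> = f w - f v"
    and "\<exists>!s. stationary s"
    and "stationary_individual (\<mu>1, \<mu>2, \<nu>1, \<nu>2) \<longleftrightarrow>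
      (\<exists>\<omega>. stationary (\<mu>1, \<mu>2, \<omega>) \<and> \<nu>1 = (f w - f v) / f w * \<omega> \<and> \<nu>2 = \<omega> - \<nu>1)"
proof -
  show iff: "stationary (\<mu>1, \<mu>2, \<omega>) \<longleftrightarrow> \<mu>1 \<in> {\<sigma><..R} \<and> f \<mu>1 = f w - f v \<and> \<mu>2 = v \<and>
      \<omega> \<in> {\<sigma><..R} \<and> f \<omega> = f w - f v" (is "?L \<longleftrightarrow> ?R") for \<mu>1 \<mu>2 \<omega>
  proof
    assume L: ?L
    have gt: "\<sigma> < \<omega>"
      using stationary_uncongestedD(1)[OF L] gr by force
    \<comment> \<open>If \<open>f \<omega> \<le> f v\<close>, the inflow would be at most
      \<open>2 * f v < f w\<close>. So the second road contributes \<open>f v\<close>, and the first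
      contributes \<open>f w - f v < f u\<close>, which must be \<open>f \<omega>\<close>.\<close>
    have f\<omega>: "f \<omega> = f w - f v"
      using stationary_congestedD[OF L gt] gr less by (auto simp: min_def split: if_splits)
    have st: "\<mu>1 \<in> {0..R}" "\<mu>2 \<in> {0..R}" "\<omega> \<in> {0..R}" "G \<mu>1 \<omega> = G u \<mu>1" "G \<mu>2 \<omega> = G v \<mu>2"
      using L by (simp_all add: stationary_iff)
    have "flux_supply \<omega> = f \<omega>"
      using gt by (simp add: flux_supply_def)
    then have "\<mu>1 = \<omega>" "\<mu>2 = v"
      using st f\<omega> gr less incoming_congested_iff[OF u st(1,3)] incoming_free_iff[OF v st(2,3)]
      by simp_all
    then show ?R
      using st gt f\<omega> by simp
  next
    assume R: ?R
    then have *: "\<omega> \<in> {0..R}" "v \<in> {0..R}" "flux_supply \<omega> = f \<omega>" "flux_demand \<omega> = f \<sigma>" "\<mu>1 = \<omega>"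
      using \<sigma> v decr_iff(3)[of \<mu>1 \<omega>] by (auto simp: flux_supply_def flux_demand_def)
    have eqs: "G \<omega> \<omega> = G u \<omega>" "G v \<omega> = G v v"
      using incoming_congested_iff[OF u *(1,1)] incoming_free_iff[OF v *(2,1)] * R gr less
      by simp_all
    have "G u \<omega> = f \<omega>" "G v v = f v"
      using incoming_flux[OF u *(1,1) eqs(1)] incoming_flux[OF v *(2,1) eqs(2)] * R gr less
      by simp_all
    then show ?L
      using R * eqs f_w outgoing_flux[OF *(1)] by (auto simp: stationary_iff)
  qed
  have "\<exists>!\<omega>. \<omega> \<in> {\<sigma><..R} \<and> f \<omega> = f w - f v"
    using less f_w f_uv by (intro ex1_decreasing_branch) auto
  then show "\<exists>!s. stationary s"
    by (auto simp: iff Ex1_def)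
  show "stationary_individual (\<mu>1, \<mu>2, \<nu>1, \<nu>2) \<longleftrightarrow>
      (\<exists>\<omega>. stationary (\<mu>1, \<mu>2, \<omega>) \<and> \<nu>1 = (f w - f v) / f w * \<omega> \<and> \<nu>2 = \<omega> - \<nu>1)"
    using gr less by (intro stationary_individual_iff_ratio) (auto simp: iff flux_supply_def)
qed

text \<open>The two hypotheses add up to \<open>f u + f v > f w\<close>, so cell \<open>J\<close> is
  congested. Then \<open>f \<omega> = f w / 2\<close> is strictly below both \<open>f u\<close> and
  \<open>f v\<close>, which congests both roads.\<close>

lemma both_roads_congested:
  assumes gr: "f u > f w / 2" "f v > f w / 2"
  shows "stationary (\<mu>1, \<mu>2, \<omega>) \<longleftrightarrow> \<mu>1 = \<omega> \<and> \<mu>2 = \<omega> \<and> \<omega> \<in> {\<sigma><..R} \<and> f \<omega> = f w / 2"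
    and "\<exists>!s. stationary s"
    and "stationary_individual (\<mu>1, \<mu>2, \<nu>1, \<nu>2) \<longleftrightarrow>
      (\<exists>\<omega>. stationary (\<mu>1, \<mu>2, \<omega>) \<and> \<nu>1 = \<omega> / 2 \<and> \<nu>2 = \<omega> / 2)"
proof -
  show iff: "stationary (\<mu>1, \<mu>2, \<omega>) \<longleftrightarrow>
      \<mu>1 = \<omega> \<and> \<mu>2 = \<omega> \<and> \<omega> \<in> {\<sigma><..R} \<and> f \<omega> = f w / 2" (is "?L \<longleftrightarrow> ?R") for \<mu>1 \<mu>2 \<omega>
  proof
    assume L: ?L
    have gt: "\<sigma> < \<omega>"
      using stationary_uncongestedD(1)[OF L] gr by force
    \<comment> \<open>If \<open>f \<omega>\<close> were above \<open>f w / 2\<close>, both minima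
      would be above it too; if it were below, both would be below. Neither sums to
      \<open>f w\<close>.\<close>
    have f\<omega>: "f \<omega> = f w / 2"
      using stationary_congestedD[OF L gt] gr by (auto simp: min_def split: if_splits)
    have st: "\<mu>1 \<in> {0..R}" "\<mu>2 \<in> {0..R}" "\<omega> \<in> {0..R}" "G \<mu>1 \<omega> = G u \<mu>1" "G \<mu>2 \<omega> = G v \<mu>2"
      using L by (simp_all add: stationary_iff)
    have "flux_supply \<omega> = f \<omega>"
      using gt by (simp add: flux_supply_def)
    then have "\<mu>1 = \<omega>" "\<mu>2 = \<omega>"
      using st f\<omega> gr incoming_congested_iff[OF u st(1,3)] incoming_congested_iff[OF v st(2,3)]
      by simp_all
    then show ?R
      using st gt f\<omega> by simp
  next
    assume R: ?R
    then have *: "\<omega> \<in> {0..R}" "flux_supply \<omega> = f \<omega>" "flux_demand \<omega> = f \<sigma>"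
      using \<sigma> by (auto simp: flux_supply_def flux_demand_def)
    have eqs: "G \<omega> \<omega> = G u \<omega>" "G \<omega> \<omega> = G v \<omega>"
      using incoming_congested_iff[OF u *(1,1)] incoming_congested_iff[OF v *(1,1)] * R gr
      by simp_all
    have "G u \<omega> = f \<omega>" "G v \<omega> = f \<omega>"
      using incoming_flux[OF u *(1,1) eqs(1)] incoming_flux[OF v *(1,1) eqs(2)] * R gr
      by simp_all
    then show ?L
      using R * eqs f_w outgoing_flux[OF *(1)] by (auto simp: stationary_iff)
  qed
  have "\<exists>!\<omega>. \<omega> \<in> {\<sigma><..R} \<and> f \<omega> = f w / 2"
    using f_w by (intro ex1_decreasing_branch) auto
  then show "\<exists>!s. stationary s"
    by (auto simp: iff Ex1_def)
  have "stationary_individual (\<mu>1, \<mu>2, \<nu>1, \<nu>2) \<longleftrightarrow>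
      (\<exists>\<omega>. stationary (\<mu>1, \<mu>2, \<omega>) \<and> \<nu>1 = 1 / 2 * \<omega> \<and> \<nu>2 = \<omega> - \<nu>1)"
    using gr f_w by (intro stationary_individual_iff_ratio) (auto simp: iff flux_supply_def)
  then show "stationary_individual (\<mu>1, \<mu>2, \<nu>1, \<nu>2) \<longleftrightarrow>
      (\<exists>\<omega>. stationary (\<mu>1, \<mu>2, \<omega>) \<and> \<nu>1 = \<omega> / 2 \<and> \<nu>2 = \<omega> / 2)"
    by (auto simp: field_simps)
qed

end

theorem theorem5p1:
  fixes f :: "real \<Rightarrow> real" and \<rho>max \<sigma> dx dt u v w1 w2 w :: real
  assumes "\<rho>max > 0"
    and "continuous_on {0..\<rho>max} f"
    and "f C1_differentiable_on {0<..<\<rho>max}"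
    and "strictly_concave_on {0..\<rho>max} f"
    and "f 0 = 0" and "f \<rho>max = 0"
    and "\<sigma> = arg_max_on f {0<..<\<rho>max}"
    and "dx > 0" and "dt > 0"
    and "u \<in> {0<..<\<sigma>}" and "v \<in> {0<..<\<sigma>}"
    and "w1 \<ge> 0" and "w2 \<ge> 0"
    and "w = w1 + w2" and "w \<in> {\<sigma><..<\<rho>max}"
  defines "stationary \<equiv> merge_stationary f \<rho>max \<sigma> dx dt u v w1 w2"
    and "stationary_individual \<equiv> merge_stationary_individual f \<rho>max \<sigma> dx dt u v w1 w2"
  shows
    "(f u + f v < f w \<longrightarrow>
        (\<exists>!s. stationary s) \<and>
        (\<forall>\<mu>1 \<mu>2 \<omega>. stationary (\<mu>1, \<mu>2, \<omega>) \<longleftrightarrow>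
           \<mu>1 = u \<and> \<mu>2 = v \<and> \<omega> \<in> {0..<\<sigma>} \<and> f \<omega> = f u + f v) \<and>
        (\<exists>!s. stationary_individual s) \<and>
        (\<forall>\<mu>1 \<mu>2 \<nu>1 \<nu>2. stationary_individual (\<mu>1, \<mu>2, \<nu>1, \<nu>2) \<longleftrightarrow>
           (\<exists>\<omega>. stationary (\<mu>1, \<mu>2, \<omega>) \<and>
              \<nu>1 = f u / (f u + f v) * \<omega> \<and> \<nu>2 = \<omega> - \<nu>1)))
     \<and>
     (f u + f v > f w \<and> f v < f w / 2 \<longrightarrow>
        (\<exists>!s. stationary s) \<and>
        (\<forall>\<mu>1 \<mu>2 \<omega>. stationary (\<mu>1, \<mu>2, \<omega>) \<longleftrightarrow>
           \<mu>1 \<in> {\<sigma><..\<rho>max} \<and> f \<mu>1 = f w - f v \<and> \<mu>2 = v \<and>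
           \<omega> \<in> {\<sigma><..\<rho>max} \<and> f \<omega> = f w - f v) \<and>
        (\<exists>!s. stationary_individual s) \<and>
        (\<forall>\<mu>1 \<mu>2 \<nu>1 \<nu>2. stationary_individual (\<mu>1, \<mu>2, \<nu>1, \<nu>2) \<longleftrightarrow>
           (\<exists>\<omega>. stationary (\<mu>1, \<mu>2, \<omega>) \<and>
              \<nu>1 = (f w - f v) / f w * \<omega> \<and> \<nu>2 = \<omega> - \<nu>1)))
     \<and>
     (f u > f w / 2 \<and> f v > f w / 2 \<longrightarrow>
        (\<exists>!s. stationary s) \<and>
        (\<forall>\<mu>1 \<mu>2 \<omega>. stationary (\<mu>1, \<mu>2, \<omega>) \<longleftrightarrow>
           \<mu>1 = \<omega> \<and> \<mu>2 = \<omega> \<and> \<omega> \<in> {\<sigma><..\<rho>max} \<and> f \<omega> = f w / 2) \<and>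
        (\<exists>!s. stationary_individual s) \<and>
        (\<forall>\<mu>1 \<mu>2 \<nu>1 \<nu>2. stationary_individual (\<mu>1, \<mu>2, \<nu>1, \<nu>2) \<longleftrightarrow>
           (\<exists>\<omega>. stationary (\<mu>1, \<mu>2, \<omega>) \<and> \<nu>1 = \<omega> / 2 \<and> \<nu>2 = \<omega> / 2)))"
proof -
  interpret unimodal_flux f \<rho>max \<sigma>
    using assms by (intro unimodal_flux_arg_max)
  interpret merge_scheme f \<rho>max \<sigma> dx dt u v w1 w2 w
    using assms by unfold_locales
  show ?thesis
    unfolding stationary_def stationary_individual_def
    by (intro conjI impI allI; (elim conjE)?;
        intro ex1_stationary_individual free_flow one_road_congested both_roads_congested)
qed

end
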